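(* There exist an open set $\mathcal{U}\subset\mathbb{R}^4$, a Lipschitz continuous function $f\colon\mathcal{U}\to\mathbb{R}$, and a periodic (real-)analytic curve $\gamma\colon\mathbb{R}\to\mathcal{U}$ satisfying $$\dot\gamma(t)\in-\partial f(\gamma(t))\quad\text{for all } t\in\mathbb{R}\qquad\text{and}\qquad \operatorname{Im}(\gamma)\cap\mathrm{Crit}(f)=\emptyset.$$
   Context: For a (locally) Lipschitz function $f\colon\mathcal{U}\to\mathbb{R}$ on an open set $\mathcal{U}\subset\mathbb{R}^d$, let $\mathcal{D}_f\subset\mathcal{U}$ be the set of points where $f$ is differentiable (it has full Lebesgue measure in $\mathcal{U}$ by Rademacher's theorem). The Clarke subdifferential of $f$ at $x\in\mathcal{U}$ is $$\partial f(x):=\mathrm{conv}\Big\{\lim_{k\to\infty}\nabla f(x_k):\ x_k\to x,\ \{x_k\}\subset\mathcal{D}_f\Big\},$$ where only sequences for which the limit exists are considered and $\mathrm{conv}$ denotes the convex hull. A point $x$ is (Clarke) critical for $f$ if $0\in\partial f(x)$; $\mathrm{Crit}(f)$ denotes the set of all critical points of $f$. $\operatorname{Im}(\gamma)$ denotes the image of $\gamma$. *)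

theory Defs
  imports "HOL-Analysis.Analysis"
begin

text \<open>Functions on an open set \<open>U\<close> are represented by total functions, whose values outside \<open>U\<close>
  are irrelevant. As \<open>U\<close> is open, differentiability at a point of \<open>U\<close> depends only on the
  values on \<open>U\<close>. In the next definition \<open>X\<close> is a sequence of points of differentiability
  in \<open>U\<close> and \<open>G\<close> is the sequence of the gradients of \<open>f\<close> there.\<close>

definition clarke_subdifferential ::
    "'a::euclidean_space set \<Rightarrow> ('a \<Rightarrow> real) \<Rightarrow> 'a \<Rightarrow> 'a set" where
  "clarke_subdifferential U f x =
     convex hull {l. \<exists>X G. (\<forall>k::nat. X k \<in> U \<and> (GDERIV f (X k) :> G k)) \<and>
                           X \<longlonglongrightarrow> x \<and> G \<longlonglongrightarrow> l}"

definition Crit :: "'a::euclidean_space set \<Rightarrow> ('a \<Rightarrow> real) \<Rightarrow> 'a set" where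
  "Crit U f = {x \<in> U. 0 \<in> clarke_subdifferential U f x}"

definition real_analytic_curve :: "(real \<Rightarrow> 'a::euclidean_space) \<Rightarrow> bool" where
  "real_analytic_curve \<gamma> \<longleftrightarrow>
     (\<forall>t\<^sub>0. \<exists>r>0. \<exists>a. \<forall>t. \<bar>t - t\<^sub>0\<bar> < r \<longrightarrow> (\<lambda>n. (t - t\<^sub>0) ^ n *\<^sub>R a n) sums \<gamma> t)"

end

theory Submission
  imports Defs
begin

text \<open>The curve is the unit circle \<open>z = e\<^sup>i\<^sup>t\<close> in the plane of the first two coordinates, and
  \<open>f(x) = \<phi>(arg z + x\<^sub>3) + x\<^sub>3\<close>, where \<open>\<phi>\<close> is Lipschitz and \<open>2\<pi>\<close>-periodic with slope \<open>-1\<close> near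
  every point of a dense set: \<open>\<phi>(\<theta>) + \<theta>\<close> is, up to a factor, the measure of the part of \<open>[-\<pi>, \<theta>]\<close>
  outside a small open set containing the rationals. Where \<open>\<phi>\<close> has slope \<open>p\<close>, on the circle the
  gradient of \<open>f\<close> is \<open>p\<close> along the unit tangent and \<open>p + 1\<close> along \<open>x\<^sub>3\<close>; for \<open>p = -1\<close> this is minus
  the velocity. Tangential minus third component is always \<open>-1\<close>, because \<open>f\<close> decreases at unit rate
  along the screw motion that advances \<open>arg z\<close> and lowers \<open>x\<^sub>3\<close>. This affine relation passes to
  limits and convex hulls, so no Clarke subgradient on the circle vanishes.\<close>

section \<open>Periodic Lipschitz functions of the argument\<close>

text \<open>Jordan's inequality: by concavity the sine lies above its chord from \<open>0\<close> to
  \<open>pi / 2\<close>.\<close>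

lemma sin_ge_linear:
  fixes x :: real
  assumes "0 \<le> x" "x \<le> pi / 2"
  shows "2 / pi * x \<le> sin x"
proof -
  have "concave_on {0..pi} sin"
    by (rule f''_le0_imp_concave[where f' = cos and f'' = "\<lambda>x. - sin x"])
       (auto intro!: derivative_eq_intros sin_ge_zero)
  from concave_onD[OF this, of "2 / pi * x" 0 "pi / 2"] show ?thesis
    using assms by (simp add: field_simps)
qed

lemma norm_cis_diff: "norm (cis a - cis b) = 2 * \<bar>sin ((a - b) / 2)\<bar>"
proof -
  have "cis a - cis b = cis b * (exp (\<i> * of_real (a - b)) - 1)"
    by (simp add: cis_conv_exp algebra_simps flip: exp_add)
  then show ?thesis
    by (simp only: norm_mult norm_cis dist_exp_i_1 mult_1)
qed

text \<open>The points \<open>cis a\<close> and \<open>cis b\<close> are joined by two arcs, one of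
  them through angle \<open>pi\<close>, where the matching end values of \<phi> allow the crossing.
  The shorter arc is at most \<open>pi / 2\<close> times the chord.\<close>

lemma circle_function_lipschitz:
  fixes \<phi> :: "real \<Rightarrow> real"
  assumes lip: "L-lipschitz_on {-pi..pi} \<phi>" and per: "\<phi> (-pi) = \<phi> pi"
    and ab: "a \<in> {-pi..pi}" "b \<in> {-pi..pi}"
  shows "\<bar>\<phi> a - \<phi> b\<bar> \<le> L * pi / 2 * norm (cis a - cis b)"
  using ab
proof (induction a b rule: linorder_wlog)
  case (sym a b)
  then show ?case by (simp add: abs_minus_commute norm_minus_commute)
next
  case (le a b)
  have L: "0 \<le> L" using lip by (rule lipschitz_on_nonneg)
  \<comment> \<open>Half the angle between the points, so that the chord has length
    \<open>2 * sin d\<close>.\<close>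
  define d where "d = (b - a) / 2"
  have d: "0 \<le> d" "d \<le> pi" using le by (auto simp: d_def)
  have chord: "norm (cis a - cis b) = 2 * sin d"
    using sin_ge_zero[OF d] norm_cis_diff[of b a]
    by (simp add: d_def norm_minus_commute)
  have short: "\<bar>\<phi> a - \<phi> b\<bar> \<le> L * (2 * d)"
    using lipschitz_onD[OF lip, of a b] le by (simp add: dist_real_def d_def field_simps)
  have "\<bar>\<phi> a - \<phi> (-pi)\<bar> \<le> L * (a + pi)" "\<bar>\<phi> b - \<phi> pi\<bar> \<le> L * (pi - b)"
    using lipschitz_onD[OF lip, of a "-pi"] lipschitz_onD[OF lip, of b pi] le
    by (simp_all add: dist_real_def)
  then have "\<bar>\<phi> a - \<phi> b\<bar> \<le> L * (a + pi) + L * (pi - b)"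
    using per by linarith
  also have "\<dots> = L * (2 * (pi - d))"
    by (simp add: d_def field_simps)
  finally have long: "\<bar>\<phi> a - \<phi> b\<bar> \<le> L * (2 * (pi - d))" .
  \<comment> \<open>Here \<open>e\<close> is half the length of the shorter arc: \<open>d\<close> or
    \<open>pi - d\<close>. Both have the same sine, and the one chosen lies in the range of Jordan's
    inequality.\<close>
  have "\<exists>e. \<bar>\<phi> a - \<phi> b\<bar> \<le> L * (2 * e) \<and> 2 / pi * e \<le> sin d"
  proof (cases "d \<le> pi / 2")
    case True
    then show ?thesis using short sin_ge_linear[of d] d by blast
  next
    case False
    then show ?thesis using long sin_ge_linear[of "pi - d"] d by (intro exI[of _ "pi - d"]) auto
  qed
  then obtain e where e: "\<bar>\<phi> a - \<phi> b\<bar> \<le> L * (2 * e)" "2 / pi * e \<le> sin d" by blast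
  have "2 * e \<le> pi / 2 * (2 * sin d)" using e(2) by (simp add: field_simps)
  from mult_left_mono[OF this L] e(1) chord show ?case by simp
qed

lemma norm_sgn_diff_le:
  fixes z w :: "'a::real_normed_vector"
  assumes "z \<noteq> 0"
  shows "norm (sgn z - sgn w) \<le> 2 * norm (z - w) / norm z"
\<comment> \<open>Since \<open>sgn 0 = 0\<close>, this case compares \<open>1\<close> with
  \<open>2\<close>.\<close>
proof (cases "w = 0")
  case True
  then show ?thesis using assms by (simp add: norm_sgn)
next
  case False
  \<comment> \<open>Both summands on the right have norm at most \<open>norm (z - w)\<close>, the
    second by the reverse triangle inequality; hence the factor 2.\<close>
  have "norm z *\<^sub>R (sgn z - sgn w) = (z - w) + (norm w - norm z) *\<^sub>R sgn w"
    using assms False by (simp add: sgn_div_norm algebra_simps)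
  then have "norm z * norm (sgn z - sgn w) = norm ((z - w) + (norm w - norm z) *\<^sub>R sgn w)"
    by (metis norm_scaleR abs_norm_cancel)
  also have "\<dots> \<le> norm (z - w) + \<bar>norm w - norm z\<bar> * 1"
    using norm_triangle_ineq[of "z - w" "(norm w - norm z) *\<^sub>R sgn w"] False
    by (simp add: norm_sgn)
  also have "\<dots> \<le> 2 * norm (z - w)"
    using norm_triangle_ineq3[of w z] by (simp add: norm_minus_commute)
  finally show ?thesis using assms by (simp add: field_simps)
qed

text \<open>The jump of \<open>Arg\<close> across the negative real axis is harmless because \<phi>
  agrees at \<open>-pi\<close> and \<open>pi\<close>. The constant is the product of
  \<open>L * pi / 2\<close> from the chord estimate and \<open>2 / r\<close> from radial projection
  to the unit circle.\<close>

lemma Arg_function_lipschitz: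
  fixes \<phi> :: "real \<Rightarrow> real"
  assumes lip: "L-lipschitz_on {-pi..pi} \<phi>" and per: "\<phi> (-pi) = \<phi> pi" and "0 < r"
  shows "(L * pi / r)-lipschitz_on {z. r \<le> norm z} (\<lambda>z. \<phi> (Arg z))"
proof (rule lipschitz_onI)
  have L: "0 \<le> L" using lip by (rule lipschitz_on_nonneg)
  then show "0 \<le> L * pi / r" using \<open>0 < r\<close> by simp
  fix z w :: complex assume "z \<in> {z. r \<le> norm z}" "w \<in> {z. r \<le> norm z}"
  then have zw: "r \<le> norm z" "r \<le> norm w" "z \<noteq> 0" "w \<noteq> 0" using \<open>0 < r\<close> by auto
  have Arg: "cis (Arg z) = sgn z" "cis (Arg w) = sgn w"
       "Arg z \<in> {-pi..pi}" "Arg w \<in> {-pi..pi}"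
    using zw Arg_bounded[of z] Arg_bounded[of w] by (auto simp: cis_Arg)
  have "norm (sgn z - sgn w) \<le> 2 * norm (z - w) / r"
    using norm_sgn_diff_le[OF zw(3), of w] zw(1) \<open>0 < r\<close>
      frac_le[of "2 * norm (z - w)" "2 * norm (z - w)" r "norm z"] by simp
  then have "L * pi / 2 * norm (sgn z - sgn w) \<le> L * pi / 2 * (2 * norm (z - w) / r)"
    using L by (intro mult_left_mono) auto
  also have "\<dots> = L * pi / r * dist z w" by (simp add: dist_norm)
  finally have "L * pi / 2 * norm (cis (Arg z) - cis (Arg w)) \<le> L * pi / r * dist z w"
    unfolding Arg(1,2) .
  with circle_function_lipschitz[OF lip per Arg(3,4)]
  show "dist (\<phi> (Arg z)) (\<phi> (Arg w)) \<le> L * pi / r * dist z w"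
    unfolding dist_real_def by (rule order_trans)
qed

section \<open>A Lipschitz function with slope -1 near a dense set\<close>

text \<open>An interval inside \<open>V\<close> adds nothing to the measure \<psi>, so there only
  the term \<open>- x\<close> of \<phi> varies. Elsewhere \<psi> grows at rate at most 1, which
  keeps \<phi> Lipschitz.\<close>

lemma locally_decreasing_lipschitz_function:
  obtains \<phi> :: "real \<Rightarrow> real" and L where "L-lipschitz_on {-pi..pi} \<phi>" "\<phi> (-pi) = \<phi> pi"
    "\<forall>x\<in>\<rat>. -pi < x \<longrightarrow> x < pi \<longrightarrow> (\<forall>\<^sub>F y in nhds x. \<phi> y = \<phi> x - (y - x))"
proof -
  have "negligible (\<Union>x\<in>\<rat>. {x :: real})"
    by (intro negligible_countable_Union) (auto simp: countable_rat)
  then have neg: "negligible (\<rat> :: real set)" by simp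
  have "\<rat> \<in> sets (lebesgue :: real measure)"
    using negligible_imp_measurable[OF neg] by blast
  \<comment> \<open>Outer regularity bounds only \<open>V - \<rat>\<close>; as the rationals are
    negligible, \<open>V\<close> itself has measure below 1.\<close>
  then obtain V :: "real set" where V: "open V" "\<rat> \<subseteq> V" "V - \<rat> \<in> lmeasurable"
      "emeasure lebesgue (V - \<rat>) < 1"
    using sets_lebesgue_outer_open[of \<rat> 1] by (metis ennreal_1 zero_less_one)
  have V_eq: "V = (V - \<rat>) \<union> \<rat>" using V(2) by blast
  have Vm: "V \<in> lmeasurable"
    by (subst V_eq) (intro fmeasurable.Un V(3) negligible_imp_measurable neg)
  have "measure lebesgue V \<le> measure lebesgue (V - \<rat>) + measure lebesgue (\<rat> :: real set)"
    by (subst V_eq) (intro measure_Un_le, use V(3) negligible_imp_measurable[OF neg] in auto)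
  also have "\<dots> < 1"
    using V(4) negligible_imp_measure0[OF neg] emeasure_eq_measure2[OF V(3)] by simp
  finally have V1: "measure lebesgue V < 1" .
  define \<psi> where "\<psi> x = measure lebesgue ({-pi..x} - V)" for x
  have meas: "{u..v} - V \<in> lmeasurable" for u v
    using Vm by (intro fmeasurable.Diff) auto
  have split: "\<psi> y = \<psi> x + measure lebesgue ({x..y} - V)" if "-pi \<le> x" "x \<le> y" for x y
  proof -
    have *: "{-pi..y} - V = ({-pi..x} - V) \<union> ({x..y} - V)" using that by auto
    have "({-pi..x} - V) \<inter> ({x..y} - V) \<subseteq> {x}" by auto
    then have "negligible (({-pi..x} - V) \<inter> ({x..y} - V))"
      using negligible_sing negligible_subset by blast
    then show ?thesis
      unfolding \<psi>_def * by (intro measure_Un3[THEN trans] meas)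
        (simp add: negligible_imp_measure0)
  qed
  have incr: "0 \<le> \<psi> y - \<psi> x \<and> \<psi> y - \<psi> x \<le> y - x" if "-pi \<le> x" "x \<le> y" for x y
  proof -
    have "measure lebesgue ({x..y} - V) \<le> measure lebesgue {x..y}"
      by (rule measure_mono_fmeasurable) (use meas in auto)
    then show ?thesis using split[OF that] that by simp
  qed
  \<comment> \<open>As \<open>V\<close> has measure below \<open>2 * pi\<close>, it cannot exhaust
    the interval; this makes the division by \<open>\<psi> pi\<close> meaningful.\<close>
  have "2 * pi = measure lebesgue {-pi..pi}" by simp
  also have "\<dots> \<le> measure lebesgue (({-pi..pi} - V) \<union> V)"
    by (rule measure_mono_fmeasurable) (use meas Vm in auto)
  also have "\<dots> \<le> \<psi> pi + measure lebesgue V"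
    unfolding \<psi>_def by (rule measure_Un_le) (use meas Vm in auto)
  finally have pos: "0 < \<psi> pi" using V1 pi_gt3 by simp
  \<comment> \<open>This factor gives \<open>c * \<psi> pi = 2 * pi\<close>, which exactly balances
    the drop of \<open>- x\<close> over one period.\<close>
  define c where "c = 2 * pi / \<psi> pi"
  have c: "0 < c" using pos by (simp add: c_def)
  define \<phi> where "\<phi> x = c * \<psi> x - x" for x
  show thesis
  proof
    show "(c + 1)-lipschitz_on {-pi..pi} \<phi>"
    proof (rule lipschitz_onI)
      fix x y :: real assume "x \<in> {-pi..pi}" "y \<in> {-pi..pi}"
      then show "dist (\<phi> x) (\<phi> y) \<le> (c + 1) * dist x y"
      proof (induction x y rule: linorder_wlog)
        case (sym a b)
        then show ?case by (simp add: dist_commute)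
      next
        case (le x y)
        then have i: "0 \<le> \<psi> y - \<psi> x" "\<psi> y - \<psi> x \<le> y - x" using incr[of x y] by auto
        from mult_left_mono[OF i(2), of c] mult_left_mono[OF i(1), of c] c le(1)
        have "0 \<le> c * \<psi> y - c * \<psi> x" "c * \<psi> y - c * \<psi> x \<le> c * (y - x)"
          by (simp_all add: algebra_simps)
        then show ?case using le(1) by (simp add: \<phi>_def dist_real_def abs_if algebra_simps)
      qed
    qed (use c in simp)
    have "\<psi> (-pi) = 0"
      unfolding \<psi>_def
      by (rule negligible_imp_measure0, rule negligible_subset[of "{-pi}"]) auto
    then show "\<phi> (-pi) = \<phi> pi" using pos by (simp add: \<phi>_def c_def)
    show "\<forall>x\<in>\<rat>. -pi < x \<longrightarrow> x < pi \<longrightarrow> (\<forall>\<^sub>F y in nhds x. \<phi> y = \<phi> x - (y - x))"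
    proof (intro ballI impI)
      fix x :: real assume "x \<in> \<rat>" and "-pi < x" "x < pi"
      with V(2) have x: "x \<in> V" "-pi < x" "x < pi" by auto
      obtain e where e: "0 < e" "ball x e \<subseteq> V" using V(1) x(1) openE by blast
      \<comment> \<open>The radius \<open>e\<close> keeps the points in \<open>V\<close>, and
        \<open>x + pi\<close> keeps them to the right of \<open>-pi\<close>, where \<psi> is
        additive.\<close>
      have "\<phi> y = \<phi> x - (y - x)" if y: "y \<in> ball x (min e (x + pi))" for y
      proof -
        have "\<psi> v = \<psi> u" if "u \<le> v" "u \<in> ball x (min e (x + pi))" "v \<in> ball x (min e (x + pi))" for u v
        proof -
          have "{u..v} \<subseteq> ball x e" using that(2,3) by (auto simp: dist_real_def)
          then have "{u..v} - V = {}" using e(2) by blast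
          moreover have "-pi \<le> u" using that by (auto simp: dist_real_def)
          ultimately show ?thesis using split[of u v] that(1) by (simp only: measure_empty)
        qed
        from this[of x y] this[of y x] have "\<psi> y = \<psi> x" using y e(1) x by (cases "x \<le> y") auto
        then show ?thesis by (simp add: \<phi>_def)
      qed
      moreover have "\<forall>\<^sub>F y in nhds x. y \<in> ball x (min e (x + pi))"
        using e(1) x(2) by (intro eventually_nhds_in_open) auto
      ultimately show "\<forall>\<^sub>F y in nhds x. \<phi> y = \<phi> x - (y - x)"
        by (rule eventually_mono[rotated])
    qed
  qed
qed

section \<open>Plane coordinates and the screw symmetry\<close>

definition plane :: "real ^ 4 \<Rightarrow> complex" where
  "plane x = Complex (x $ 1) (x $ 2)"

definition lift_plane :: "complex \<Rightarrow> real ^ 4" where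
  "lift_plane z = Re z *\<^sub>R axis 1 1 + Im z *\<^sub>R axis 2 1"

text \<open>Multiplying by \<open>cis (x $ 3)\<close> adds \<open>x $ 3\<close> to the argument, and
  \<open>Arg\<close> then reduces the sum modulo \<open>2 * pi\<close> into the interval on which
  \<phi> is controlled.\<close>

definition screw_potential :: "(real \<Rightarrow> real) \<Rightarrow> real ^ 4 \<Rightarrow> real" where
  "screw_potential \<phi> x = \<phi> (Arg (plane x * cis (x $ 3))) + x $ 3"

lemma bounded_linear_lift_plane: "bounded_linear lift_plane"
  unfolding lift_plane_def by (intro bounded_linear_intros bounded_linear_Re bounded_linear_Im)

lemma bounded_linear_plane: "bounded_linear plane"
proof -
  have "plane = (\<lambda>x. (x $ 1) *\<^sub>R 1 + (x $ 2) *\<^sub>R \<i>)"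
    by (simp add: plane_def fun_eq_iff complex_eq_iff)
  moreover have "bounded_linear \<dots>"
    by (intro bounded_linear_add bounded_linear_scaleR_const bounded_linear_vec_nth)
  ultimately show ?thesis by simp
qed

lemma plane_lift_plane [simp]: "plane (lift_plane z) = z"
  by (simp add: plane_def lift_plane_def axis_def)

lemma lift_plane_nth_3 [simp]: "lift_plane z $ 3 = 0"
  by (simp add: lift_plane_def axis_def)

lemma plane_axis_3 [simp]: "plane (axis 3 c) = 0"
  by (simp add: plane_def axis_def complex_eq_iff)

text \<open>\<open>lift_plane\<close> is the adjoint of \<open>plane\<close>; this turns derivatives
  expressed through \<open>plane\<close> into gradient vectors.\<close>

lemma inner_lift_plane: "x \<bullet> lift_plane z = plane x \<bullet> z"
  by (simp add: plane_def lift_plane_def inner_add_right inner_axis inner_complex_def)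

lemma norm_plane_le: "norm (plane x) \<le> norm x"
proof -
  have "(norm (plane x))\<^sup>2 \<le> (norm x)\<^sup>2"
    unfolding power2_norm_eq_inner by (simp add: plane_def inner_complex_def inner_vec_def sum_4)
  then show ?thesis by (simp add: power2_le_iff_abs_le)
qed

text \<open>Rotating by \<open>a\<close> while lowering the third coordinate by \<open>a\<close>
  fixes \<open>plane x * cis (x $ 3)\<close>, so only the summand \<open>x $ 3\<close>
  changes.\<close>

lemma screw_potential_screw:
  "screw_potential \<phi> (x + lift_plane (plane x * (cis a - 1)) - a *\<^sub>R axis 3 1) = screw_potential \<phi> x - a"
proof -
  interpret plane: bounded_linear plane by (rule bounded_linear_plane)
  have "plane (x + lift_plane (plane x * (cis a - 1)) - a *\<^sub>R axis 3 1) = plane x * cis a"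
    by (simp add: plane.add plane.diff plane.scaleR algebra_simps)
  moreover have "plane x * cis a * cis (x $ 3 - a) = plane x * cis (x $ 3)"
    by (simp add: cis_mult mult.assoc)
  moreover have "(x + lift_plane (plane x * (cis a - 1)) - a *\<^sub>R axis 3 1) $ 3 = x $ 3 - a"
    by (simp add: axis_def)
  ultimately show ?thesis
    by (simp only: screw_potential_def)
qed

lemma cis_has_vector_derivative: "(cis has_vector_derivative \<i> * cis t) (at t)"
  unfolding has_vector_derivative_def by (intro has_derivative_cis has_derivative_ident)

section \<open>Gradients and Clarke subgradients of the potential\<close>

text \<open>This is the chain rule along the screw orbit through \<open>x\<close>, on which the
  potential is affine with slope -1. It holds at every point of differentiability, for any
  \<phi>.\<close>

lemma gradient_screw_potential:
  assumes "GDERIV (screw_potential \<phi>) x :> g"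
  shows "g \<bullet> (lift_plane (\<i> * plane x) - axis 3 1) = -1"
proof -
  let ?c = "\<lambda>a. x + lift_plane (plane x * (cis a - 1)) - a *\<^sub>R axis 3 1"
  interpret lift_plane: bounded_linear lift_plane by (rule bounded_linear_lift_plane)
  have "((\<lambda>a. plane x * (cis a - 1)) has_vector_derivative \<i> * plane x) (at 0)"
    by (auto intro!: derivative_eq_intros cis_has_vector_derivative)
  from lift_plane.has_vector_derivative[OF this]
  have c: "(?c has_vector_derivative lift_plane (\<i> * plane x) - axis 3 1) (at 0)"
    by (auto intro!: derivative_eq_intros)
  have "?c 0 = x" by (simp add: lift_plane.zero)
  then have "(screw_potential \<phi> has_derivative (\<lambda>h. h \<bullet> g)) (at (?c 0))"
    using assms by (simp add: gderiv_def)
  from has_derivative_compose[OF c[unfolded has_vector_derivative_def] this]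
  have "((\<lambda>a. screw_potential \<phi> (?c a)) has_real_derivative
      (lift_plane (\<i> * plane x) - axis 3 1) \<bullet> g) (at 0)"
    by (simp add: has_field_derivative_def inner_scaleR_left mult_commute_abs)
  moreover have "((\<lambda>a. screw_potential \<phi> x - a) has_real_derivative -1) (at 0)"
    by (auto intro!: derivative_eq_intros)
  ultimately show ?thesis
    unfolding screw_potential_screw by (metis DERIV_unique inner_commute)
qed

text \<open>The screw velocity depends continuously on the point, so the gradient identity survives
  limits. All limits then lie in one hyperplane, which is convex and hence contains their
  hull.\<close>

lemma clarke_subdifferential_screw_potential:
  assumes "g \<in> clarke_subdifferential U (screw_potential \<phi>) x"
  shows "g \<bullet> (lift_plane (\<i> * plane x) - axis 3 1) = -1"
proof -
  let ?v = "\<lambda>x. lift_plane (\<i> * plane x) - axis 3 1"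
  interpret lift_plane: bounded_linear lift_plane by (rule bounded_linear_lift_plane)
  interpret plane: bounded_linear plane by (rule bounded_linear_plane)
  let ?S = "{l. \<exists>X G. (\<forall>k::nat. X k \<in> U \<and> (GDERIV (screw_potential \<phi>) (X k) :> G k)) \<and>
                           X \<longlonglongrightarrow> x \<and> G \<longlonglongrightarrow> l}"
  have "?S \<subseteq> {g. ?v x \<bullet> g = -1}"
  proof clarify
    fix l X G
    assume G: "\<forall>k::nat. X k \<in> U \<and> (GDERIV (screw_potential \<phi>) (X k) :> G k)"
      and lim: "X \<longlonglongrightarrow> x" "G \<longlonglongrightarrow> l"
    have "(\<lambda>k. G k \<bullet> ?v (X k)) \<longlonglongrightarrow> l \<bullet> ?v x"
      using lim by (intro tendsto_intros lift_plane.tendsto plane.tendsto)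
    moreover have "G k \<bullet> ?v (X k) = -1" for k
      using G gradient_screw_potential by blast
    ultimately show "?v x \<bullet> l = -1"
      by (simp add: LIMSEQ_const_iff inner_commute)
  qed
  from hull_minimal[OF this, of convex, OF convex_hyperplane] have "g \<in> {g. ?v x \<bullet> g = -1}"
    using assms unfolding clarke_subdifferential_def by (rule subsetD)
  then show ?thesis by (simp add: inner_commute)
qed

text \<open>With slope -1, the \<phi> term contributes \<open>- x $ 3\<close>, which cancels the
  summand \<open>x $ 3\<close>. Locally the potential is a constant minus the argument of
  \<open>plane x\<close>, with gradient \<open>- \<i> * z\<close> at a unit vector
  \<open>z\<close>.\<close>

lemma gradient_screw_potential_decreasing:
  assumes dec: "\<forall>\<^sub>F y in nhds (t + s). \<phi> y = \<phi> (t + s) - (y - (t + s))"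
    and ts: "-pi < t + s" "t + s < pi"
  shows "GDERIV (screw_potential \<phi>) (lift_plane (cis t) + s *\<^sub>R axis 3 1) :> - lift_plane (\<i> * cis t)"
proof -
  interpret plane: bounded_linear plane by (rule bounded_linear_plane)
  define x where "x = lift_plane (cis t) + s *\<^sub>R axis 3 1"
  define w where "w y = plane y * cis (y $ 3)" for y
  have x: "plane x = cis t" "x $ 3 = s"
    by (simp add: x_def plane.add plane.scaleR) (simp add: x_def axis_def)
  then have wx: "w x = cis (t + s)" by (simp add: w_def cis_mult)
  have Arg: "Arg (w x) = t + s" unfolding wx using ts by (intro Arg_cis) auto
  \<comment> \<open>Off the branch cut \<open>Arg\<close> is continuous and \<open>Ln\<close> is
    differentiable.\<close>
  have nonpos: "w x \<notin> \<real>\<^sub>\<le>\<^sub>0"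
  proof
    assume "w x \<in> \<real>\<^sub>\<le>\<^sub>0"
    moreover have "w x \<noteq> 0" by (simp add: wx)
    ultimately have "Arg (w x) = pi" by (auto simp: Arg_eq_pi complex_nonpos_Reals_iff complex_eq_iff)
    then show False using Arg ts by simp
  qed
  have nth: "bounded_linear (\<lambda>y :: real ^ 4. y $ 3)" by (rule bounded_linear_vec_nth)
  have cis': "(cis has_derivative (\<lambda>h. h *\<^sub>R (\<i> * cis s))) (at (x $ 3))"
    using cis_has_vector_derivative[of s] by (simp add: has_vector_derivative_def x)
  have "((\<lambda>y. cis (y $ 3)) has_derivative (\<lambda>h. (h $ 3) *\<^sub>R (\<i> * cis s))) (at x)"
    by (rule has_derivative_compose[OF bounded_linear_imp_has_derivative[OF nth] cis'])
  from has_derivative_mult[OF bounded_linear_imp_has_derivative[OF bounded_linear_plane] this]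
  have w': "(w has_derivative (\<lambda>h. cis t * ((h $ 3) *\<^sub>R (\<i> * cis s)) + plane h * cis s)) (at x)"
    by (simp add: w_def[abs_def] x)
  have "continuous (at x) w"
    using w' has_derivative_continuous by blast
  then have "filterlim w (nhds (w x)) (nhds x)"
    by (simp add: continuous_at tendsto_at_iff_tendsto_nhds)
  moreover have "filterlim Arg (nhds (t + s)) (nhds (w x))"
    using continuous_at_Arg[OF nonpos]
    by (simp add: continuous_at tendsto_at_iff_tendsto_nhds flip: Arg)
  ultimately have "filterlim (\<lambda>y. Arg (w y)) (nhds (t + s)) (nhds x)"
    by (rule filterlim_compose[rotated])
  from eventually_compose_filterlim[OF dec this]
  have ev1: "\<forall>\<^sub>F y in nhds x. screw_potential \<phi> y = \<phi> (t + s) - (Arg (w y) - (t + s)) + y $ 3"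
    by eventually_elim (simp add: screw_potential_def w_def)
  have "\<forall>\<^sub>F v in nhds (w x). v \<noteq> 0"
    by (rule t1_space_nhds) (simp add: wx)
  then have ev2: "\<forall>\<^sub>F y in nhds x. w y \<noteq> 0"
    using \<open>filterlim w (nhds (w x)) (nhds x)\<close> by (rule eventually_compose_filterlim)
  \<comment> \<open>\<open>Arg\<close> is replaced by \<open>Im (Ln _)\<close> in order to use the
    complex derivative of \<open>Ln\<close>.\<close>
  have ev: "\<forall>\<^sub>F y in nhds x. screw_potential \<phi> y = \<phi> (t + s) - (Im (Ln (w y)) - (t + s)) + y $ 3"
    using ev1 ev2 by eventually_elim (simp add: Arg_eq_Im_Ln)
  have "((\<lambda>y. Ln (w y)) has_derivative
      (\<lambda>h. inverse (w x) * (cis t * ((h $ 3) *\<^sub>R (\<i> * cis s)) + plane h * cis s))) (at x)"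
    by (rule has_derivative_compose[OF w' has_field_derivative_Ln[OF nonpos, unfolded has_field_derivative_def]])
  also have "(\<lambda>h. inverse (w x) * (cis t * ((h $ 3) *\<^sub>R (\<i> * cis s)) + plane h * cis s)) =
      (\<lambda>h. \<i> * of_real (h $ 3) + plane h * cnj (cis t))"
  proof
    fix h
    have "w x = cis t * cis s" "cnj (cis t) = inverse (cis t)"
      by (simp_all add: wx cis_cnj cis_mult)
    then show "inverse (w x) * (cis t * ((h $ 3) *\<^sub>R (\<i> * cis s)) + plane h * cis s) =
      \<i> * of_real (h $ 3) + plane h * cnj (cis t)"
      by (simp add: scaleR_conv_of_real field_simps)
  qed
  finally have "((\<lambda>y. \<phi> (t + s) - (Im (Ln (w y)) - (t + s)) + y $ 3) has_derivative
      (\<lambda>h. - Im (\<i> * of_real (h $ 3) + plane h * cnj (cis t)) + h $ 3)) (at x)"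
    by (auto intro!: derivative_eq_intros bounded_linear_imp_has_derivative[OF nth])
  \<comment> \<open>The terms in \<open>h $ 3\<close> cancel, and the imaginary part of
    \<open>p * cnj z\<close> is the inner product of \<open>p\<close> with
    \<open>\<i> * z\<close>.\<close>
  also have "(\<lambda>h. - Im (\<i> * of_real (h $ 3) + plane h * cnj (cis t)) + h $ 3) =
      (\<lambda>h. h \<bullet> - lift_plane (\<i> * cis t))"
    by (simp add: fun_eq_iff inner_lift_plane inner_complex_def algebra_simps)
  finally have "(screw_potential \<phi> has_derivative (\<lambda>h. h \<bullet> - lift_plane (\<i> * cis t))) (at x)"
  proof (rule has_derivative_transform_eventually)
    show "\<forall>\<^sub>F y in at x. \<phi> (t + s) - (Im (Ln (w y)) - (t + s)) + y $ 3 = screw_potential \<phi> y"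
      using ev by (auto simp: eventually_nhds_conv_at elim: eventually_mono)
    show "\<phi> (t + s) - (Im (Ln (w x)) - (t + s)) + x $ 3 = screw_potential \<phi> x"
      using eventually_nhds_x_imp_x[OF ev] by simp
  qed simp
  then show ?thesis
    unfolding gderiv_def x_def .
qed

text \<open>The circle point is approached vertically, through heights \<open>s\<close> that make
  the angle plus \<open>s\<close> rational. The gradient at all these points is the same vector, so
  a constant sequence of gradients has the required limit.\<close>

lemma minus_velocity_in_clarke_subdifferential:
  assumes dec: "\<And>y. y \<in> \<rat> \<Longrightarrow> -pi < y \<Longrightarrow> y < pi \<Longrightarrow> \<forall>\<^sub>F u in nhds y. \<phi> u = \<phi> y - (u - y)"
    and U: "open U" "lift_plane (cis t) \<in> U"
  shows "- lift_plane (\<i> * cis t) \<in> clarke_subdifferential U (screw_potential \<phi>) (lift_plane (cis t))"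
proof -
  define \<theta> where "\<theta> = Arg (cis t)"
  have \<theta>: "-pi < \<theta>" "\<theta> \<le> pi" "cis \<theta> = cis t"
    using Arg_bounded[of "cis t"] by (auto simp: \<theta>_def cis_Arg)
  let ?x = "\<lambda>s. lift_plane (cis t) + s *\<^sub>R axis 3 1"
  have "\<exists>s. \<bar>s\<bar> < e \<and> ?x s \<in> U \<and> (GDERIV (screw_potential \<phi>) (?x s) :> - lift_plane (\<i> * cis t))"
    if e: "0 < e" for e :: real
  proof -
    obtain d where d: "0 < d" "ball (lift_plane (cis t)) d \<subseteq> U" using U openE by blast
    \<comment> \<open>The rational is taken below \<theta> because \<theta> may equal
      \<open>pi\<close>, while the slope of \<phi> is known only strictly inside the
      interval.\<close>
    have "max (-pi) (\<theta> - min d e) < \<theta>" using \<theta> d e by simp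
    then obtain y where y: "y \<in> \<rat>" "max (-pi) (\<theta> - min d e) < y" "y < \<theta>"
      using Rats_dense_in_real by blast
    define s where "s = y - \<theta>"
    have s: "\<bar>s\<bar> < e" "\<bar>s\<bar> < d" using y by (auto simp: s_def)
    then have "?x s \<in> U" using d(2) by (auto simp: subset_iff dist_norm)
    moreover have "GDERIV (screw_potential \<phi>) (?x s) :> - lift_plane (\<i> * cis t)"
      using gradient_screw_potential_decreasing[of \<phi> \<theta> s] dec[of y] y \<theta> by (simp add: s_def)
    ultimately show ?thesis using s by blast
  qed
  then have "\<exists>s. \<bar>s\<bar> < inverse (real (Suc k)) \<and> ?x s \<in> U \<and>
      (GDERIV (screw_potential \<phi>) (?x s) :> - lift_plane (\<i> * cis t))" for k
    by simp
  then obtain S where S: "\<And>k. \<bar>S k\<bar> < inverse (real (Suc k))" "\<And>k. ?x (S k) \<in> U"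
      "\<And>k. GDERIV (screw_potential \<phi>) (?x (S k)) :> - lift_plane (\<i> * cis t)"
    by metis
  have "S \<longlonglongrightarrow> 0"
    using S(1) by (intro Lim_null_comparison[OF _ LIMSEQ_inverse_real_of_nat])
      (auto intro!: always_eventually less_imp_le)
  then have "(\<lambda>k. ?x (S k)) \<longlonglongrightarrow> lift_plane (cis t) + 0 *\<^sub>R axis 3 1"
    by (intro tendsto_intros)
  then show ?thesis
    unfolding clarke_subdifferential_def
    using S(2,3)
    by (intro hull_inc CollectI exI[of _ "\<lambda>k. ?x (S k)"] exI[of _ "\<lambda>k. - lift_plane (\<i> * cis t)"]) auto
qed

section \<open>Lipschitz continuity, analyticity and the conclusion\<close>

text \<open>The inner radius keeps \<open>plane x * cis (x $ 3)\<close> away from the singularity of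
  \<open>Arg\<close>; the outer radius bounds how fast this product turns with
  \<open>x $ 3\<close>.\<close>

lemma screw_potential_lipschitz:
  assumes "L-lipschitz_on {-pi..pi} \<phi>" and "\<phi> (-pi) = \<phi> pi" and "0 < r"
  shows "\<exists>M. M-lipschitz_on {x. r < norm (plane x) \<and> norm (plane x) < R} (screw_potential \<phi>)"
proof -
  interpret plane: bounded_linear plane by (rule bounded_linear_plane)
  let ?U = "{x. r < norm (plane x) \<and> norm (plane x) < R}"
  have nth: "1-lipschitz_on ?U (\<lambda>x. x $ 3)"
    by (rule lipschitz_onI) (simp_all add: dist_vec_nth_le)
  have w: "(1 + \<bar>R\<bar>)-lipschitz_on ?U (\<lambda>x. plane x * cis (x $ 3))"
  proof (rule lipschitz_onI)
    fix x y assume xy: "x \<in> ?U" "y \<in> ?U"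
    have "plane x * cis (x $ 3) - plane y * cis (y $ 3) =
        plane (x - y) * cis (x $ 3) + plane y * (cis (x $ 3) - cis (y $ 3))"
      by (simp add: plane.diff algebra_simps)
    then have "dist (plane x * cis (x $ 3)) (plane y * cis (y $ 3)) \<le>
        norm (plane (x - y)) + norm (plane y) * norm (cis (x $ 3) - cis (y $ 3))"
      unfolding dist_norm by (metis norm_triangle_ineq norm_mult norm_cis mult.right_neutral)
    also have "norm (cis (x $ 3) - cis (y $ 3)) \<le> \<bar>x $ 3 - y $ 3\<bar>"
      using abs_sin_x_le_abs_x[of "(x $ 3 - y $ 3) / 2"] by (simp add: norm_cis_diff)
    also have "\<bar>x $ 3 - y $ 3\<bar> \<le> dist x y"
      using dist_vec_nth_le[of x 3 y] by (simp add: dist_real_def)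
    also have "norm (plane y) \<le> \<bar>R\<bar>" using xy by auto
    also have "norm (plane (x - y)) \<le> dist x y" using norm_plane_le by (simp add: dist_norm)
    finally show "dist (plane x * cis (x $ 3)) (plane y * cis (y $ 3)) \<le> (1 + \<bar>R\<bar>) * dist x y"
      by (simp add: algebra_simps mult_right_mono mult_left_mono)
  qed simp
  have "(L * pi / r)-lipschitz_on ((\<lambda>x. plane x * cis (x $ 3)) ` ?U) (\<lambda>z. \<phi> (Arg z))"
    by (rule lipschitz_on_subset[OF Arg_function_lipschitz[OF assms]]) (auto simp: norm_mult)
  from lipschitz_on_add[OF lipschitz_on_compose2[OF w this] nth] show ?thesis
    unfolding screw_potential_def[abs_def] by blast
qed

lemma lift_plane_cis_has_vector_derivative:
  "((\<lambda>t. lift_plane (cis t)) has_vector_derivative lift_plane (\<i> * cis t)) (at t)"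
  by (rule bounded_linear.has_vector_derivative[OF bounded_linear_lift_plane cis_has_vector_derivative])

text \<open>The exponential series of \<open>\<i> * (t - t0)\<close>, multiplied by
  \<open>cis t0\<close>, is mapped termwise by the bounded linear \<open>lift_plane\<close>. It
  converges for all \<open>t\<close>, so radius 1 serves.\<close>

lemma real_analytic_lift_plane_cis: "real_analytic_curve (\<lambda>t. lift_plane (cis t))"
  unfolding real_analytic_curve_def
proof (intro allI exI conjI impI)
  fix t0 t :: real
  interpret lift_plane: bounded_linear lift_plane by (rule bounded_linear_lift_plane)
  have "(\<lambda>n. cis t0 * ((\<i> * of_real (t - t0)) ^ n /\<^sub>R fact n)) sums (cis t0 * exp (\<i> * of_real (t - t0)))"
    by (intro sums_mult exp_converges)
  also have "cis t0 * exp (\<i> * of_real (t - t0)) = cis t"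
    by (simp add: cis_conv_exp algebra_simps flip: exp_add)
  also have "(\<lambda>n. cis t0 * ((\<i> * of_real (t - t0)) ^ n /\<^sub>R fact n)) =
      (\<lambda>n. (t - t0) ^ n *\<^sub>R (cis t0 * \<i> ^ n /\<^sub>R fact n))"
    by (simp add: fun_eq_iff scaleR_conv_of_real power_mult_distrib)
  finally show "(\<lambda>n. (t - t0) ^ n *\<^sub>R lift_plane (cis t0 * \<i> ^ n /\<^sub>R fact n)) sums lift_plane (cis t)"
    using lift_plane.sums by (fastforce simp: lift_plane.scaleR)
qed (rule zero_less_one)

theorem theorem5:
  shows "\<exists>(U :: (real ^ 4) set) (f :: real ^ 4 \<Rightarrow> real) (\<gamma> :: real \<Rightarrow> real ^ 4).
     open U \<and> (\<exists>L. L-lipschitz_on U f) \<and>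
     range \<gamma> \<subseteq> U \<and> real_analytic_curve \<gamma> \<and> (\<exists>T>0. \<forall>t. \<gamma> (t + T) = \<gamma> t) \<and>
     (\<forall>t. vector_derivative \<gamma> (at t) \<in> uminus ` clarke_subdifferential U f (\<gamma> t)) \<and>
     range \<gamma> \<inter> Crit U f = {}"
proof -
  obtain \<phi> L where \<phi>: "L-lipschitz_on {-pi..pi} \<phi>" "\<phi> (-pi) = \<phi> pi" 
      "\<forall>x\<in>\<rat>. -pi < x \<longrightarrow> x < pi \<longrightarrow> (\<forall>\<^sub>F y in nhds x. \<phi> y = \<phi> x - (y - x))"
    by (rule locally_decreasing_lipschitz_function)
  \<comment> \<open>An annulus around the unit circle times the remaining two coordinates; the radii
    only have to satisfy \<open>0 < r < 1 < R\<close>.\<close>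
  let ?U = "{x. 1 / 2 < norm (plane x) \<and> norm (plane x) < 2}"
  let ?f = "screw_potential \<phi>" and ?\<gamma> = "\<lambda>t. lift_plane (cis t)"
  have "open ?U"
    by (intro open_Collect_conj open_Collect_less continuous_intros
        linear_continuous_on bounded_linear_plane)
  moreover have "vector_derivative ?\<gamma> (at t) \<in> uminus ` clarke_subdifferential ?U ?f (?\<gamma> t)" for t
  proof -
    have "- lift_plane (\<i> * cis t) \<in> clarke_subdifferential ?U ?f (?\<gamma> t)"
      using \<phi>(3) \<open>open ?U\<close> by (intro minus_velocity_in_clarke_subdifferential) auto
    then show ?thesis
      unfolding vector_derivative_at[OF lift_plane_cis_has_vector_derivative]
      by (rule rev_image_eqI) simp
  qed
  \<comment> \<open>The zero vector has inner product 0, not -1, with the screw velocity.\<close>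
  moreover have "range ?\<gamma> \<inter> Crit ?U ?f = {}"
    unfolding Crit_def using clarke_subdifferential_screw_potential[of 0 ?U \<phi>] by auto
  moreover have "\<forall>t. ?\<gamma> (t + 2 * pi) = ?\<gamma> t" "0 < 2 * pi"
    by (simp_all add: complex_eq_iff flip: cis_mult)
  moreover have "range ?\<gamma> \<subseteq> ?U" by auto
  moreover have "\<exists>L. L-lipschitz_on ?U ?f"
    using \<phi>(1,2) by (intro screw_potential_lipschitz) auto
  ultimately show ?thesis
    using real_analytic_lift_plane_cis by blast
qed

end
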